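(* We have $$\sum_{n\geq1}c_n(1\text{-}11)t^n=\sum_{m\geq1}\frac{(1+t)^{m+1}}{\sqrt{t(1+t)}\;U_m\!\left(\frac{\sqrt{1+t}}{2\sqrt{t}}\right)U_{m+1}\!\left(\frac{\sqrt{1+t}}{2\sqrt{t}}\right)}.$$
   Context: A Catalan word of length $n\ge 1$ is a sequence $\pi=\pi_1\cdots\pi_n$ of positive integers with $\pi_1=1$ and $\pi_{i+1}\le \pi_i+1$ for $1\le i\le n-1$; $\mathcal{C}_n$ is the set of these. A word $\pi$ contains the vincular pattern $1\text{-}11$ if there are indices $i<j$ with $j+1\le n$ such that $\pi_i=\pi_j=\pi_{j+1}$; otherwise $\pi$ avoids it. $c_n(\tau)$ denotes the number of members of $\mathcal{C}_n$ avoiding $\tau$. $U_n$ is the Chebyshev polynomial of the second kind: $U_0(x)=1$, $U_1(x)=2x$, $U_n(x)=2xU_{n-1}(x)-U_{n-2}(x)$ for $n\ge2$. The identity is one of power series in $t$; the same $\sqrt t$ and $\sqrt{1+t}$ are used throughout, with $\sqrt{t(1+t)}=\sqrt t\,\sqrt{1+t}$, and the square roots cancel so that each summand is a rational function of $t$, expanded about $t=0$. *)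

theory Defs
  imports
    "HOL-Computational_Algebra.Polynomial_FPS"
    "HOL-Computational_Algebra.Formal_Laurent_Series"
begin

text \<open>Words are lists; positions are 0-based, so \<open>w ! i\<close> is the letter $\pi_{i+1}$.\<close>

definition catalan_words :: "nat \<Rightarrow> nat list set" where
  "catalan_words n =
     {w. length w = n \<and> (\<forall>i<n. 1 \<le> w ! i) \<and> w ! 0 = 1 \<and>
         (\<forall>i. i + 1 < n \<longrightarrow> w ! (i + 1) \<le> w ! i + 1)}"

definition contains_1_11 :: "nat list \<Rightarrow> bool" where
  "contains_1_11 w \<longleftrightarrow>
     (\<exists>i j. i < j \<and> j + 1 < length w \<and> w ! i = w ! j \<and> w ! j = w ! (j + 1))"

definition c_1_11 :: "nat \<Rightarrow> nat" where
  "c_1_11 n = card {w \<in> catalan_words n. \<not> contains_1_11 w}"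

lemma finite_catalan_words: "n \<ge> 1 \<Longrightarrow> finite (catalan_words n)"
proof -
  assume n: "n \<ge> 1"
  have bound: "w ! i \<le> i + 1" if "w \<in> catalan_words n" "i < n" for w i
    using that(2)
  proof (induction i)
    case 0
    then show ?case using that(1) by (simp add: catalan_words_def)
  next
    case (Suc i)
    have "w ! (i + 1) \<le> w ! i + 1"
      using that(1) Suc.prems by (simp add: catalan_words_def)
    moreover have "w ! i \<le> i + 1" using Suc by simp
    ultimately show ?case by simp
  qed
  have "catalan_words n \<subseteq> {w. set w \<subseteq> {..n} \<and> length w = n}"
  proof
    fix w assume w: "w \<in> catalan_words n"
    have "length w = n" using w by (simp add: catalan_words_def)
    moreover have "set w \<subseteq> {..n}"
    proof
      fix x assume "x \<in> set w"
      then obtain i where "i < n" "x = w ! i"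
        using \<open>length w = n\<close> by (auto simp: in_set_conv_nth)
      then show "x \<in> {..n}" using bound[OF w, of i] by simp
    qed
    ultimately show "w \<in> {w. set w \<subseteq> {..n} \<and> length w = n}" by simp
  qed
  then show ?thesis
    by (rule finite_subset) (rule finite_lists_length_eq, simp)
qed

text \<open>Chebyshev polynomials of the second kind, as functions on a commutative ring.\<close>

fun cheb_U :: "nat \<Rightarrow> 'a::comm_ring_1 \<Rightarrow> 'a" where
  "cheb_U 0 x = 1"
| "cheb_U (Suc 0) x = 2 * x"
| "cheb_U (Suc (Suc n)) x = 2 * x * cheb_U (Suc n) x - cheb_U n x"

text \<open>
  The square roots live in the field of formal Laurent series in a variable $s$, called
  \<open>fls_X\<close>, with $s^2 = t$. Power series in $t$, where $t$ is \<open>fps_X\<close>, embed into this field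
  by \<open>subst_sq\<close>, which substitutes $s^2$ for $t$.
\<close>

definition subst_sq :: "rat fps \<Rightarrow> rat fls" where
  "subst_sq F = fls_compose_power (fps_to_fls F) 2"

definition sqrt_t :: "rat fls" where
  "sqrt_t = fls_X"

text \<open>The binomial series for the exponent $1/2$.\<close>

definition sqrt_1_plus_t :: "rat fls" where
  "sqrt_1_plus_t = subst_sq (fps_binomial (1/2))"

lemma sqrt_t_sq: "sqrt_t ^ 2 = subst_sq fps_X"
  by (simp add: sqrt_t_def subst_sq_def fls_X_power_conv_shift_1)

lemma sqrt_1_plus_t_sq: "sqrt_1_plus_t ^ 2 = subst_sq (1 + fps_X)"
proof -
  have "fps_binomial (1/2) * fps_binomial (1/2) = (1 + fps_X :: rat fps)"
    by (simp add: fps_binomial_add_mult[symmetric] fps_binomial_1)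
  then show ?thesis
    by (simp add: sqrt_1_plus_t_def subst_sq_def power2_eq_square
        fls_compose_power_mult[symmetric] fls_times_fps_to_fls[symmetric])
qed

lemma inj_subst_sq: "inj subst_sq"
proof (rule injI)
  fix F G assume eq: "subst_sq F = subst_sq G"
  show "F = G"
  proof (rule fps_ext)
    fix n
    have "fls_nth (subst_sq H) (2 * int n) = fps_nth H n" for H
      by (simp add: subst_sq_def fls_nth_compose_power)
    with eq show "fps_nth F n = fps_nth G n" by metis
  qed
qed

text \<open>\<open>F\<close> is the expansion about $0$ of a rational function of $t$ that is regular at $0$.\<close>

definition rational_fps :: "rat fps \<Rightarrow> bool" where
  "rational_fps F \<longleftrightarrow>
     (\<exists>p q. poly q 0 \<noteq> 0 \<and> F = fps_of_poly p / fps_of_poly q)"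

end

theory Submission
  imports Defs
begin

text \<open>
  An avoiding Catalan word is read from left to right. The only information about a prefix that
  decides how it may be continued is its last letter \<open>a\<close>, its maximum \<open>m\<close> (a Catalan word uses
  every letter between \<open>1\<close> and its maximum), and whether its last letter occurs there for the
  first time: exactly then may that letter be repeated at once. So the word is a path in an
  automaton, and the generating functions of the paths satisfy a linear system.

  Let \<open>F m a\<close> be the series of continuations in the state with last letter \<open>a\<close> and maximum \<open>m\<close> in
  which repetition is forbidden. A newly reached maximum \<open>m\<close> can be doubled or not, so that its
  continuations have the series \<open>(1 + t) F m m\<close>. Subtracting the equations for \<open>a\<close> and \<open>a - 1\<close>
  leaves
  \[ (1 + t) F_{m,a} = t F_{m,a+1} + (1 + t) F_{m,a-1}, \]
  where \<open>F m (m + 1)\<close> stands for \<open>(1 + t) F (m + 1) (m + 1)\<close>. Gaussian elimination from the bottom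
  letter upwards gives
  \[ D_m F_{m,m} = t (1 + t) D_{m-1} F_{m+1,m+1} + (1 + t)^{m-1}, \]
  with the polynomials $D_0 = D_1 = 1$, $D_{k+2} = (1 + t) D_{k+1} - t (1 + t) D_k$
  (lemma \<open>eliminated_equation\<close>). After division by $D_{m-1} D_m$ this first-order recurrence in \<open>m\<close>
  telescopes (lemma \<open>telescoping_step\<close>): the series of all words is the sum of
  \[ \frac{t^m (1 + t)^{2m-1}}{D_{m-1} D_m} \]
  over \<open>m\<close>, because the remainder after \<open>m\<close> terms is divisible by $t^{m+1}$. Finally,
  $\sqrt{1+t}\,D_k = \sqrt{1+t}^{\,k} \sqrt{t}^{\,k+1} U_{k+1}$, as both sides obey the same recurrence
  (lemma \<open>denom_eq_cheb_U\<close>); this turns the terms into the quotients of Chebyshev polynomials.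
\<close>

section \<open>The automaton of avoiding words\<close>

definition avoiding :: "nat list \<Rightarrow> bool" where
  "avoiding w \<longleftrightarrow> w \<in> catalan_words (length w) \<and> \<not> contains_1_11 w"

text \<open>
  \<open>continues fresh m a w\<close> says that \<open>w\<close> may follow a prefix with last letter \<open>a\<close> and maximum \<open>m\<close>,
  where \<open>fresh\<close> records that \<open>a\<close> has just occurred for the first time.
\<close>

fun continues :: "bool \<Rightarrow> nat \<Rightarrow> nat \<Rightarrow> nat list \<Rightarrow> bool" where
  "continues fresh m a [] \<longleftrightarrow> True"
| "continues fresh m a (b # w) \<longleftrightarrow> b \<in> {1..a + 1} \<and>
     (if b = a then fresh \<and> continues False m a w else continues (b > m) (max m b) b w)"

lemma catalan_words_snoc:
  assumes "p \<noteq> []"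
  shows "p @ [b] \<in> catalan_words (Suc (length p)) \<longleftrightarrow>
           p \<in> catalan_words (length p) \<and> b \<in> {1..last p + 1}"
proof -
  define k where "k = length p - 1"
  have k: "length p = Suc k" and l: "last p = p ! k"
    using assms by (auto simp: k_def last_conv_nth Suc_le_eq)
  have "(\<forall>i<Suc (Suc k). 1 \<le> (p @ [b]) ! i) \<longleftrightarrow> (\<forall>i<Suc k. 1 \<le> p ! i) \<and> 1 \<le> b"
    using k by (auto simp: nth_append less_Suc_eq)
  moreover have "(\<forall>i. i + 1 < Suc (Suc k) \<longrightarrow> (p @ [b]) ! (i + 1) \<le> (p @ [b]) ! i + 1) \<longleftrightarrow>
      (\<forall>i. i + 1 < Suc k \<longrightarrow> p ! (i + 1) \<le> p ! i + 1) \<and> b \<le> last p + 1"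
    using k l by (auto simp: nth_append less_Suc_eq)
  ultimately show ?thesis
    using k by (auto simp: catalan_words_def nth_append)
qed

lemma contains_1_11_snoc:
  assumes "p \<noteq> []"
  shows "contains_1_11 (p @ [b]) \<longleftrightarrow>
           contains_1_11 p \<or> (b = last p \<and> last p \<in> set (butlast p))"
    (is "?L \<longleftrightarrow> ?R")
proof -
  define k where "k = length p - 1"
  have k: "length p = Suc k" and l: "last p = p ! k"
    using assms by (auto simp: k_def last_conv_nth Suc_le_eq)
  have last_in: "last p \<in> set (butlast p) \<longleftrightarrow> (\<exists>i<k. p ! i = p ! k)"
    using k l by (auto simp: in_set_conv_nth nth_butlast)
  show ?thesis
  proof
    assume ?L
    then obtain i j where ij: "i < j" "j + 1 < length (p @ [b])" "(p @ [b]) ! i = (p @ [b]) ! j"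
      "(p @ [b]) ! j = (p @ [b]) ! (j + 1)"
      unfolding contains_1_11_def by blast
    show ?R
    proof (cases "j = k")
      case True
      then show ?thesis using ij k l last_in by (auto simp: nth_append)
    next
      case False
      then have "j + 1 < length p" using ij k by simp
      then have "contains_1_11 p"
        using ij unfolding contains_1_11_def
        by (intro exI[of _ i] exI[of _ j]) (auto simp: nth_append)
      then show ?thesis by blast
    qed
  next
    assume ?R
    then show ?L
    proof
      assume "contains_1_11 p"
      then obtain i j where ij: "i < j" "j + 1 < length p" "p ! i = p ! j" "p ! j = p ! (j + 1)"
        unfolding contains_1_11_def by blast
      then show ?L
        unfolding contains_1_11_def
        by (intro exI[of _ i] exI[of _ j]) (auto simp: nth_append)
    next
      assume r: "b = last p \<and> last p \<in> set (butlast p)"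
      then obtain i where "i < k" "p ! i = p ! k" using last_in by blast
      then show ?L
        unfolding contains_1_11_def using r k l
        by (intro exI[of _ i] exI[of _ k]) (auto simp: nth_append)
    qed
  qed
qed

lemma avoiding_snoc:
  assumes "p \<noteq> []"
  shows "avoiding (p @ [b]) \<longleftrightarrow>
           avoiding p \<and> b \<in> {1..last p + 1} \<and> (b = last p \<longrightarrow> last p \<notin> set (butlast p))"
  using assms by (auto simp: avoiding_def catalan_words_snoc contains_1_11_snoc)

lemma avoiding_prefix: "avoiding (p @ w) \<Longrightarrow> p \<noteq> [] \<Longrightarrow> avoiding p"
  by (induction w rule: rev_induct) (auto simp: avoiding_snoc simp flip: append_assoc)

text \<open>
  The state of the automaton determines the legal continuations. That the letters of the prefix
  fill \<open>{1..m}\<close> is what makes the maximum sufficient to recognise a first occurrence.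
\<close>

lemma avoiding_append_iff_continues:
  assumes "avoiding p" "p \<noteq> []" "set p = {1..m}"
  shows "avoiding (p @ w) \<longleftrightarrow> continues (last p \<notin> set (butlast p)) m (last p) w"
  using assms
proof (induction w arbitrary: p m)
  case Nil
  then show ?case by simp
next
  case (Cons b w)
  let ?q = "p @ [b]"
  have last: "last p \<in> {1..m}"
    using Cons.prems last_in_set by blast
  have split: "p @ b # w = ?q @ w" by simp
  show ?case
  proof (cases "avoiding ?q")
    case False
    then have "\<not> avoiding (p @ b # w)"
      unfolding split using avoiding_prefix by blast
    with False show ?thesis
      using Cons.prems by (auto simp: avoiding_snoc)
  next
    case True
    then have b: "b \<in> {1..last p + 1}" "b = last p \<longrightarrow> last p \<notin> set (butlast p)"
      using Cons.prems by (auto simp: avoiding_snoc)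
    have "set ?q = {1..max m b}"
      using Cons.prems(3) b(1) last by auto
    from Cons.IH[OF True _ this]
    have "avoiding (p @ b # w) \<longleftrightarrow> continues (b \<notin> set p) (max m b) b w"
      by simp
    moreover have "b \<notin> set p \<longleftrightarrow> b > m"
      using Cons.prems(3) b(1) by auto
    moreover have "max m b = m" "\<not> b > m" if "b = last p"
      using that last by auto
    ultimately show ?thesis
      using b by auto
  qed
qed

section \<open>Generating functions of the states\<close>

definition continuations :: "bool \<Rightarrow> nat \<Rightarrow> nat \<Rightarrow> nat \<Rightarrow> nat list set" where
  "continuations fresh m a n = {w. length w = n \<and> continues fresh m a w}"

lemma continuations_0: "continuations fresh m a 0 = {[]}"
  by (auto simp: continuations_def)

lemma continuations_Suc:
  "continuations fresh m a (Suc n) =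
     (\<Union>b\<in>{1..a + 1}. (#) b `
        (if b = a then if fresh then continuations False m a n else {}
         else continuations (b > m) (max m b) b n))"
proof -
  have "w \<in> continuations fresh m a (Suc n) \<longleftrightarrow>
     w \<in> (\<Union>b\<in>{1..a + 1}. (#) b `
        (if b = a then if fresh then continuations False m a n else {}
         else continuations (b > m) (max m b) b n))" for w
    by (cases w) (auto simp: continuations_def)
  then show ?thesis by blast
qed

lemma finite_continuations: "finite (continuations fresh m a n)"
proof (induction n arbitrary: fresh m a)
  case 0
  then show ?case by (simp add: continuations_0)
next
  case (Suc n)
  then show ?case unfolding continuations_Suc by auto
qed

lemma card_continuations_Suc:
  "card (continuations fresh m a (Suc n)) =
     (\<Sum>b\<in>{1..a + 1}.
        if b = a then if fresh then card (continuations False m a n) else 0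
        else card (continuations (b > m) (max m b) b n))"
proof -
  have "card (continuations fresh m a (Suc n)) =
     (\<Sum>b\<in>{1..a + 1}. card ((#) b `
        (if b = a then if fresh then continuations False m a n else {}
         else continuations (b > m) (max m b) b n)))"
    unfolding continuations_Suc
    by (rule card_UN_disjoint) (auto simp: finite_continuations)
  then show ?thesis
    by (simp add: card_image if_distrib cong: if_cong)
qed

lemma c_1_11_eq_card_continuations:
  "c_1_11 (Suc n) = card (continuations True 1 1 n)"
proof -
  have one: "avoiding [1]"
    by (auto simp: avoiding_def catalan_words_def contains_1_11_def)
  have eq: "{w \<in> catalan_words (Suc n). \<not> contains_1_11 w} = (#) 1 ` continuations True 1 1 n"
  proof (intro set_eqI)
    fix w
    show "w \<in> {w \<in> catalan_words (Suc n). \<not> contains_1_11 w} \<longleftrightarrow>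
          w \<in> (#) 1 ` continuations True 1 1 n"
    proof (cases w)
      case Nil
      then show ?thesis by (auto simp: catalan_words_def)
    next
      case (Cons b v)
      have "avoiding (1 # v) \<longleftrightarrow> continues True 1 1 v"
        using avoiding_append_iff_continues[OF one, of 1 v] by simp
      moreover have "w \<in> catalan_words (Suc n) \<longleftrightarrow>
          b = 1 \<and> length v = n \<and> w \<in> catalan_words (length w)"
        using Cons by (auto simp: catalan_words_def)
      ultimately show ?thesis
        using Cons by (auto simp: avoiding_def continuations_def)
    qed
  qed
  show ?thesis
    unfolding c_1_11_def eq by (simp add: card_image)
qed

definition state_fps :: "bool \<Rightarrow> nat \<Rightarrow> nat \<Rightarrow> rat fps" where
  "state_fps fresh m a = Abs_fps (\<lambda>n. of_nat (card (continuations fresh m a n)))"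

lemma state_fps_eq:
  "state_fps fresh m a = 1 + fps_X *
     (\<Sum>b\<in>{1..a + 1}. if b = a then if fresh then state_fps False m a else 0
                     else state_fps (b > m) (max m b) b)"
proof (rule fps_ext)
  fix n
  show "fps_nth (state_fps fresh m a) n = fps_nth (1 + fps_X *
     (\<Sum>b\<in>{1..a + 1}. if b = a then if fresh then state_fps False m a else 0
                     else state_fps (b > m) (max m b) b)) n"
  proof (cases n)
    case 0
    then show ?thesis by (simp add: state_fps_def continuations_0)
  next
    case (Suc k)
    have "of_nat (card (continuations fresh m a (Suc k))) =
      (\<Sum>b\<in>{1..a + 1}. fps_nth (if b = a then if fresh then state_fps False m a else 0
                     else state_fps (b > m) (max m b) b) k)"
      unfolding card_continuations_Suc of_nat_sum
      by (intro sum.cong) (auto simp: state_fps_def)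
    then show ?thesis
      using Suc by (simp add: state_fps_def fps_sum_nth)
  qed
qed

text \<open>
  A letter on its first occurrence is either followed by a copy of itself or not; the two
  possibilities leave the same choices afterwards.
\<close>

lemma state_fps_fresh:
  assumes "a \<ge> 1"
  shows "state_fps True m a = (1 + fps_X) * state_fps False m a"
proof -
  let ?g = "\<lambda>b. state_fps (b > m) (max m b) b"
  let ?rest = "\<Sum>b\<in>{1..a + 1} - {a}. ?g b"
  have "(\<Sum>b\<in>{1..a + 1}. if b = a then x else ?g b) = x + ?rest" for x
    using assms by (subst sum.remove[of _ a]) (auto intro!: sum.cong)
  then have "state_fps True m a = 1 + fps_X * (state_fps False m a + ?rest)"
    and "state_fps False m a = 1 + fps_X * ?rest"
    using state_fps_eq[of True m a] state_fps_eq[of False m a] by simp_all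
  then show ?thesis by (simp add: algebra_simps)
qed

text \<open>
  The series after an ascent from \<open>a\<close> to \<open>a + 1\<close>. Only at \<open>a = m\<close> does the ascent create a letter
  that may be doubled.
\<close>

definition ascent_fps :: "nat \<Rightarrow> nat \<Rightarrow> rat fps" where
  "ascent_fps m a = state_fps (a + 1 > m) (max m (a + 1)) (a + 1)"

lemma ascent_fps_below: "a < m \<Longrightarrow> ascent_fps m a = state_fps False m (a + 1)"
  by (simp add: ascent_fps_def max.absorb1)

lemma ascent_fps_max: "ascent_fps m m = (1 + fps_X) * state_fps False (m + 1) (m + 1)"
  by (simp add: ascent_fps_def state_fps_fresh)

lemma state_fps_linear_system:
  assumes "1 \<le> a" "a \<le> m"
  shows "state_fps False m a =
           1 + fps_X * ((\<Sum>b\<in>{1..<a}. state_fps False m b) + ascent_fps m a)"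
proof -
  have "{1..a + 1} = insert (a + 1) (insert a {1..<a})"
    using assms by auto
  moreover have "(\<Sum>b\<in>{1..<a}. if b = a then 0 else state_fps (b > m) (max m b) b) =
      (\<Sum>b\<in>{1..<a}. state_fps False m b)"
    using assms by (intro sum.cong) (auto simp: max_def)
  ultimately show ?thesis
    using state_fps_eq[of False m a] by (simp add: ascent_fps_def algebra_simps)
qed

section \<open>Elimination and telescoping\<close>

text \<open>
  These are the determinants of $1 - t M_k$, where $M_k$ is the adjacency matrix of the allowed
  steps on the letters \<open>{1..k}\<close> (any descent and any ascent by one).
\<close>

fun denom :: "nat \<Rightarrow> rat poly" where
  "denom 0 = 1"
| "denom (Suc 0) = 1"
| "denom (Suc (Suc k)) = [:1, 1:] * denom (Suc k) - [:0, 1:] * [:1, 1:] * denom k"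

definition denom_fps :: "nat \<Rightarrow> rat fps" where
  "denom_fps k = fps_of_poly (denom k)"

lemma fps_of_poly_one_plus_X: "fps_of_poly [:1, 1:] = (1 + fps_X :: rat fps)"
  by (simp add: fps_of_poly_linear')

lemma denom_fps_simps:
  "denom_fps 0 = 1" "denom_fps (Suc 0) = 1"
  "denom_fps (Suc (Suc k)) =
     (1 + fps_X) * denom_fps (Suc k) - fps_X * (1 + fps_X) * denom_fps k"
  unfolding denom_fps_def
  by (simp_all add: fps_of_poly_mult fps_of_poly_diff fps_of_poly_one_plus_X
      del: mult_pCons_left mult_pCons_right)

lemma poly_denom_0: "poly (denom k) 0 = 1"
  by (induction k rule: denom.induct) simp_all

lemma denom_fps_nth_0: "fps_nth (denom_fps k) 0 = 1"
  using poly_denom_0[of k] by (simp add: denom_fps_def poly_0_coeff_0)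

lemma denom_fps_nonzero: "denom_fps k \<noteq> 0"
  using denom_fps_nth_0[of k] by auto

text \<open>
  The rows of the system are eliminated in the order of increasing \<open>a\<close>: the difference of rows
  \<open>a\<close> and \<open>a - 1\<close> involves three consecutive unknowns, and the equation already known for \<open>a - 1\<close>
  removes the lowest of them. The recurrence of \<open>denom\<close> is the one produced by this step.
\<close>

lemma eliminated_equation:
  assumes "Suc k \<le> m"
  shows "denom_fps (Suc k) * state_fps False m (Suc k) =
           fps_X * denom_fps k * ascent_fps m (Suc k) + (1 + fps_X) ^ k"
  using assms
proof (induction k)
  case 0
  then show ?case
    using state_fps_linear_system[of 1 m] by (simp add: denom_fps_simps)
next
  case (Suc k)
  let ?F = "\<lambda>a. state_fps False m a"
  have asc: "ascent_fps m (Suc k) = ?F (Suc (Suc k))"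
    using Suc.prems by (simp add: ascent_fps_below)
  have IH: "denom_fps (Suc k) * ?F (Suc k) =
      fps_X * denom_fps k * ?F (Suc (Suc k)) + (1 + fps_X) ^ k"
    using Suc asc by simp
  have "?F (Suc k) = 1 + fps_X * ((\<Sum>b\<in>{1..<Suc k}. ?F b) + ?F (Suc (Suc k)))"
    using state_fps_linear_system[of "Suc k" m] Suc.prems asc by simp
  moreover have "?F (Suc (Suc k)) =
      1 + fps_X * ((\<Sum>b\<in>{1..<Suc k}. ?F b) + ?F (Suc k) + ascent_fps m (Suc (Suc k)))"
    using state_fps_linear_system[of "Suc (Suc k)" m] Suc.prems by simp
  ultimately have three_term:
    "(1 + fps_X) * ?F (Suc (Suc k)) =
       fps_X * ascent_fps m (Suc (Suc k)) + (1 + fps_X) * ?F (Suc k)"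
    by algebra
  have "denom_fps (Suc (Suc k)) * ?F (Suc (Suc k)) =
      denom_fps (Suc k) * ((1 + fps_X) * ?F (Suc (Suc k))) -
      (1 + fps_X) * (fps_X * denom_fps k * ?F (Suc (Suc k)))"
    by (simp add: denom_fps_simps algebra_simps)
  also have "\<dots> = denom_fps (Suc k) * (fps_X * ascent_fps m (Suc (Suc k))) +
      (1 + fps_X) * (denom_fps (Suc k) * ?F (Suc k) - fps_X * denom_fps k * ?F (Suc (Suc k)))"
    unfolding three_term by (simp add: algebra_simps)
  also have "\<dots> = fps_X * denom_fps (Suc k) * ascent_fps m (Suc (Suc k)) + (1 + fps_X) ^ Suc k"
    unfolding IH by (simp add: algebra_simps)
  finally show ?case .
qed

text \<open>The summand with index \<open>m = k + 1\<close>, with the square roots cancelled.\<close>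

definition summand :: "nat \<Rightarrow> rat fps" where
  "summand k = fps_X ^ Suc k * (1 + fps_X) ^ (2 * k + 1) / (denom_fps k * denom_fps (Suc k))"

text \<open>
  The unknown $F_{m,m}$ with $m = k + 1$, scaled so that the coefficient of the next unknown in the
  eliminated equation becomes \<open>1\<close>.
\<close>

definition remainder :: "nat \<Rightarrow> rat fps" where
  "remainder k = (fps_X * (1 + fps_X)) ^ Suc k * state_fps False (Suc k) (Suc k) / denom_fps k"

lemma fps_divide_mult_cancel:
  fixes f g :: "'a::field fps"
  assumes "fps_nth g 0 \<noteq> 0"
  shows "f / g * g = f"
  using assms by (simp add: fps_divide_unit mult.assoc inverse_mult_eq_1)

lemma summand_mult_denom:
  "summand k * (denom_fps k * denom_fps (Suc k)) = fps_X ^ Suc k * (1 + fps_X) ^ (2 * k + 1)"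
  unfolding summand_def by (rule fps_divide_mult_cancel) (simp add: denom_fps_nth_0)

lemma remainder_mult_denom:
  "remainder k * denom_fps k =
     (fps_X * (1 + fps_X)) ^ Suc k * state_fps False (Suc k) (Suc k)"
  unfolding remainder_def by (rule fps_divide_mult_cancel) (simp add: denom_fps_nth_0)

lemma telescoping_step: "remainder k = summand k + remainder (Suc k)"
proof -
  define F where "F = state_fps False (Suc k) (Suc k)"
  define G where "G = state_fps False (Suc (Suc k)) (Suc (Suc k))"
  define A where "A = denom_fps k"
  define B where "B = denom_fps (Suc k)"
  define Y where "Y = fps_X * (1 + fps_X :: rat fps)"
  have "B * F = fps_X * A * ((1 + fps_X) * G) + (1 + fps_X) ^ k"
    using eliminated_equation[of k "Suc k"] ascent_fps_max[of "Suc k"]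
    by (simp add: A_def B_def F_def G_def)
  then have elim: "B * F = Y * A * G + (1 + fps_X) ^ k"
    by (simp add: Y_def mult_ac)
  have r: "remainder k * A = Y ^ Suc k * F" "remainder (Suc k) * B = Y ^ Suc (Suc k) * G"
    using remainder_mult_denom[of k] remainder_mult_denom[of "Suc k"]
    by (simp_all add: A_def B_def F_def G_def Y_def)
  have "(1 + fps_X) ^ (2 * k + 1) = (1 + fps_X) ^ Suc k * (1 + fps_X :: rat fps) ^ k"
    unfolding power_add[symmetric] by (intro arg_cong2[where f = power]) simp_all
  then have s: "summand k * (A * B) = Y ^ Suc k * (1 + fps_X) ^ k"
    using summand_mult_denom[of k] by (simp add: A_def B_def Y_def power_mult_distrib mult_ac)
  have "remainder k * (A * B) = Y ^ Suc k * (B * F)"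
    using arg_cong[OF r(1), of "\<lambda>x. x * B"] by (simp only: mult_ac)
  also have "\<dots> = summand k * (A * B) + A * (Y ^ Suc (Suc k) * G)"
    unfolding elim s by (simp add: algebra_simps)
  also have "\<dots> = (summand k + remainder (Suc k)) * (A * B)"
    unfolding r(2)[symmetric] by (simp add: algebra_simps)
  finally have "remainder k * (A * B) = (summand k + remainder (Suc k)) * (A * B)" .
  moreover have "A * B \<noteq> 0"
    by (simp add: A_def B_def denom_fps_nonzero)
  ultimately show ?thesis
    by (metis mult_right_cancel)
qed

lemma remainder_eq_sum: "remainder 0 = (\<Sum>k<n. summand k) + remainder n"
proof (induction n)
  case 0
  show ?case by simp
next
  case (Suc n)
  then show ?case using telescoping_step[of n] by (simp add: add.assoc)
qed

lemma fps_nth_remainder: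
  assumes "n \<le> k"
  shows "fps_nth (remainder k) n = 0"
proof -
  have "remainder k = fps_X ^ Suc k *
      ((1 + fps_X) ^ Suc k * state_fps False (Suc k) (Suc k) * inverse (denom_fps k))"
    using denom_fps_nth_0[of k]
    by (simp add: remainder_def fps_divide_unit power_mult_distrib mult_ac)
  then show ?thesis
    using assms by (simp only: fps_X_power_mult_nth) simp
qed

lemma summand_sums_remainder: "summand sums remainder 0"
  unfolding sums_def
proof (rule tendsto_fpsI)
  fix n
  have "fps_nth (\<Sum>k<N. summand k) n = fps_nth (remainder 0) n" if "n \<le> N" for N
    using fps_nth_remainder[OF that] arg_cong[OF remainder_eq_sum[of N], of "\<lambda>f. fps_nth f n"]
    by simp
  then show "\<forall>\<^sub>F N in sequentially. fps_nth (\<Sum>k<N. summand k) n = fps_nth (remainder 0) n"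
    by (auto simp: eventually_sequentially)
qed

lemma remainder_0_eq_words_fps:
  "remainder 0 = Abs_fps (\<lambda>n. if n \<ge> 1 then of_nat (c_1_11 n) else 0)"
proof -
  have "remainder 0 = fps_X * state_fps True 1 1"
    by (simp add: remainder_def denom_fps_simps state_fps_fresh mult_ac)
  moreover have "fps_nth (fps_X * state_fps True 1 1) n =
      (if n \<ge> 1 then of_nat (c_1_11 n) else 0)" for n
    by (cases n) (simp_all add: state_fps_def c_1_11_eq_card_continuations)
  ultimately show ?thesis
    by (simp add: fps_eq_iff)
qed

section \<open>The Chebyshev form of the summands\<close>

lemma rational_fps_summand: "rational_fps (summand k)"
proof -
  have "summand k = fps_of_poly ([:0, 1:] ^ Suc k * [:1, 1:] ^ (2 * k + 1)) /
      fps_of_poly (denom k * denom (Suc k))"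
    by (simp only: summand_def denom_fps_def fps_of_poly_mult fps_of_poly_power
        fps_of_poly_fps_X fps_of_poly_one_plus_X)
  moreover have "poly (denom k * denom (Suc k)) 0 \<noteq> 0"
    by (simp add: poly_denom_0)
  ultimately show ?thesis
    unfolding rational_fps_def by blast
qed

lemma subst_sq_simps:
  "subst_sq 0 = 0" "subst_sq 1 = 1"
  "subst_sq (f + g) = subst_sq f + subst_sq g"
  "subst_sq (f - g) = subst_sq f - subst_sq g"
  "subst_sq (f * g) = subst_sq f * subst_sq g"
  by (simp_all add: subst_sq_def fls_times_fps_to_fls)

lemma subst_sq_power: "subst_sq (f ^ n) = subst_sq f ^ n"
  by (induction n) (simp_all add: subst_sq_simps)

lemma subst_sq_eq_0_iff: "subst_sq f = 0 \<longleftrightarrow> f = 0"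
  using inj_subst_sq by (metis injD subst_sq_simps(1))

lemma subst_sq_fps_X: "subst_sq fps_X = sqrt_t ^ 2"
  by (simp add: sqrt_t_sq)

lemma one_plus_subst_sq: "1 + subst_sq fps_X = sqrt_1_plus_t ^ 2"
  by (simp add: sqrt_1_plus_t_sq subst_sq_simps)

lemma sqrt_t_nonzero: "sqrt_t \<noteq> 0"
  by (simp add: sqrt_t_def)

lemma sqrt_1_plus_t_nonzero: "sqrt_1_plus_t \<noteq> 0"
proof -
  have "fps_nth (1 + fps_X :: rat fps) 0 \<noteq> 0" by simp
  then have "subst_sq (1 + fps_X) \<noteq> 0"
    unfolding subst_sq_eq_0_iff by (metis fps_zero_nth)
  then show ?thesis
    by (metis sqrt_1_plus_t_sq zero_power2)
qed

text \<open>
  With $2x = \sqrt{1+t}/\sqrt{t}$, clearing the powers of $\sqrt{t}$ from the three-term recurrence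
  of $U$ gives the recurrence of \<open>denom\<close>; the powers of $\sqrt{1+t}$ absorb the alternating factor
  that odd-index Chebyshev polynomials carry.
\<close>

lemma denom_eq_cheb_U:
  "sqrt_1_plus_t * subst_sq (denom_fps k) =
     sqrt_1_plus_t ^ k * sqrt_t ^ Suc k * cheb_U (Suc k) (sqrt_1_plus_t / (2 * sqrt_t))"
proof -
  define s where "s = sqrt_t"
  define r where "r = sqrt_1_plus_t"
  define U where "U = (\<lambda>k. cheb_U k (r / (2 * s)))"
  define D where "D = (\<lambda>k. subst_sq (denom_fps k))"
  have s: "s \<noteq> 0" by (simp add: s_def sqrt_t_nonzero)
  have r2: "r ^ 2 = 1 + s ^ 2"
    using one_plus_subst_sq by (simp add: r_def s_def subst_sq_fps_X)
  have U1: "s * U (Suc 0) = r"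
    using s by (simp add: U_def)
  have U_step: "s * U (Suc (Suc k)) = r * U (Suc k) - s * U k" for k
    using s by (simp add: U_def field_simps)
  have D_step: "D (Suc (Suc k)) = r ^ 2 * D (Suc k) - s ^ 2 * r ^ 2 * D k" for k
    unfolding D_def denom_fps_simps subst_sq_simps subst_sq_fps_X
    by (simp add: r2 s_def)
  have "r * D k = r ^ k * s ^ Suc k * U (Suc k)"
  proof (induction k rule: denom.induct)
    case 1
    then show ?case using U1 by (simp add: D_def denom_fps_simps subst_sq_simps)
  next
    case 2
    have "s * (s * U (Suc (Suc 0))) = r * (s * U (Suc 0)) - s ^ 2"
      unfolding U_step by (simp add: U_def algebra_simps power2_eq_square)
    also have "\<dots> = 1"
      unfolding U1 using r2 by (simp add: power2_eq_square)
    finally show ?case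
      by (simp add: D_def denom_fps_simps subst_sq_simps mult_ac)
  next
    case (3 k)
    have "r * D (Suc (Suc k)) = r ^ 2 * (r * D (Suc k)) - s ^ 2 * r ^ 2 * (r * D k)"
      unfolding D_step by (simp add: algebra_simps)
    also have "\<dots> = r ^ Suc (Suc k) * s ^ Suc (Suc k) *
        (r * U (Suc (Suc k)) - s * U (Suc k))"
      unfolding 3 by (simp add: algebra_simps power2_eq_square)
    also have "\<dots> = r ^ Suc (Suc k) * s ^ Suc (Suc (Suc k)) * U (Suc (Suc (Suc k)))"
      unfolding U_step[symmetric] by (simp add: mult_ac)
    finally show ?case .
  qed
  then show ?thesis
    by (simp add: r_def s_def U_def D_def)
qed

lemma subst_sq_summand:
  assumes "m = Suc k"
  shows "subst_sq (summand k) =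
    (1 + subst_sq fps_X) ^ (m + 1) /
    ((sqrt_t * sqrt_1_plus_t) *
     cheb_U m (sqrt_1_plus_t / (2 * sqrt_t)) *
     cheb_U (m + 1) (sqrt_1_plus_t / (2 * sqrt_t)))"
proof -
  define s where "s = sqrt_t"
  define r where "r = sqrt_1_plus_t"
  define U where "U = (\<lambda>k. cheb_U k (r / (2 * s)))"
  define D where "D = (\<lambda>k. subst_sq (denom_fps k))"
  define S where "S = subst_sq (summand k)"
  have s: "s \<noteq> 0" and r: "r \<noteq> 0"
    by (simp_all add: s_def r_def sqrt_t_nonzero sqrt_1_plus_t_nonzero)
  have D_nz: "D i \<noteq> 0" for i
    by (simp add: D_def subst_sq_eq_0_iff denom_fps_nonzero)
  have DU: "r * D i = r ^ i * s ^ Suc i * U (Suc i)" for i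
    using denom_eq_cheb_U[of i] by (simp add: r_def s_def U_def D_def)
  have U_nz: "U (Suc i) \<noteq> 0" for i
    using DU[of i] D_nz[of i] r by auto
  have "S * (D k * D (Suc k)) = (s ^ 2) ^ Suc k * (r ^ 2) ^ (2 * k + 1)"
    using arg_cong[OF summand_mult_denom[of k], of subst_sq]
    by (simp only: S_def D_def s_def r_def subst_sq_simps subst_sq_power
        subst_sq_fps_X[symmetric] one_plus_subst_sq[symmetric])
  then have "S * ((r * D k) * (r * D (Suc k))) = r ^ 2 * ((s ^ 2) ^ Suc k * (r ^ 2) ^ (2 * k + 1))"
    by (metis (no_types, lifting) mult.assoc mult.left_commute power2_eq_square)
  \<comment> \<open>The factor on the right collects the powers of \<open>r\<close> and \<open>s\<close> by which the denominators
    \<open>D\<close> and \<open>U\<close> differ.\<close>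
  then have "(S * (s * r * U m * U (m + 1))) * (r ^ (2 * k) * s ^ (2 * k + 2)) =
      (r ^ 2) ^ (m + 1) * (r ^ (2 * k) * s ^ (2 * k + 2))"
    unfolding DU assms
    by (simp add: power_add power_mult power_mult_distrib mult_ac power2_eq_square mult_2)
  moreover have "r ^ (2 * k) * s ^ (2 * k + 2) \<noteq> 0"
    using r s by simp
  ultimately have "S * (s * r * U m * U (m + 1)) = (r ^ 2) ^ (m + 1)"
    by (metis mult_right_cancel)
  moreover have "s * r * U m * U (m + 1) \<noteq> 0"
    using s r U_nz by (simp add: assms)
  ultimately have "S = (r ^ 2) ^ (m + 1) / (s * r * U m * U (m + 1))"
    by (metis nonzero_mult_div_cancel_right)
  then show ?thesis
    by (simp only: S_def r_def s_def U_def one_plus_subst_sq)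
qed

theorem theorem2p5:
  shows "\<exists>F :: nat \<Rightarrow> rat fps.
    (\<forall>m\<ge>1. rational_fps (F m) \<and>
       subst_sq (F m) =
         (1 + subst_sq fps_X) ^ (m + 1) /
         ((sqrt_t * sqrt_1_plus_t) *
          cheb_U m (sqrt_1_plus_t / (2 * sqrt_t)) *
          cheb_U (m + 1) (sqrt_1_plus_t / (2 * sqrt_t)))) \<and>
    (\<lambda>m. F (m + 1)) sums Abs_fps (\<lambda>n. if n \<ge> 1 then of_nat (c_1_11 n) else 0)"
proof (intro exI[of _ "\<lambda>m. summand (m - 1)"] conjI allI impI)
  fix m :: nat
  assume "m \<ge> 1"
  then have "m = Suc (m - 1)" by simp
  then show "subst_sq (summand (m - 1)) =
      (1 + subst_sq fps_X) ^ (m + 1) /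
      ((sqrt_t * sqrt_1_plus_t) *
       cheb_U m (sqrt_1_plus_t / (2 * sqrt_t)) *
       cheb_U (m + 1) (sqrt_1_plus_t / (2 * sqrt_t)))"
    by (rule subst_sq_summand)
  show "rational_fps (summand (m - 1))"
    by (rule rational_fps_summand)
next
  show "(\<lambda>m. summand (m + 1 - 1)) sums
      Abs_fps (\<lambda>n. if n \<ge> 1 then of_nat (c_1_11 n) else 0)"
    using summand_sums_remainder by (simp add: remainder_0_eq_words_fps)
qed

end
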